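(* As $n\to\infty$ we have the following. (1) For $\bm{N}=(n,n,\ldots,n,-n^2)$: $\log K_n(\bm{N})\ge n^2-O(n\log n)$. (2) For fixed $a\ge\frac1{12}$ and $N_i=a\cdot n$ (an integer) for all $i\in\{0,\ldots,n-1\}$: $\log K_n(\bm{N})\ge\frac{n^2}{2}(2+\log a)-O(n\log n)$. (3) For fixed $a\ge0$ and $N_i=a\cdot n+i$ (an integer) for all $i\in\{0,\ldots,n-1\}$: $\log K_n(\bm{N})\ge\frac{n^2}{2}(1+\log(2a+1))-O(n\log n)$, where the implied constant may depend on $a$. (4) For $N_i=n+i$ for all $i\in\{0,\ldots,n-1\}$: $\log K_n(\bm{N})\ge 1.198\,n^2-O(n\log n)$. (5) For fixed integer $t\ge1$ and $\bm{N}=(t,0,\ldots,0,-t)$: $\log_2 K_n(\bm{N})\ge\frac n2\log_2^2t-O(n\log_2t)$, with implied constant independent of $t$. (6) For fixed integer $t\ge1$ and $\bm{N}=t\cdot(n,n-2,n-4,\ldots,-n+2,-n)$: $\log K_n(\bm{N})\ge\frac{n^2}{2}\log\Big(\frac{(1+t)^{1+t}}{t^t}\Big)-O(n\log(nt))$, with implied constant independent of $t$. In (1)–(4), $\bm{N}=(N_0,\ldots,N_{n-1},-\sum_{i<n}N_i)$.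
   Context: $K_n(\bm{N})$, for $\bm{N}\in\mathbb{Z}^{n+1}$ with zero sum, is the number of integer vectors $(f_{ij})_{0\le i<j\le n}\in\mathbb{Z}_{\ge0}^{\binom{n+1}{2}}$ with $\sum_{j>i} f_{ij}-\sum_{k<i} f_{ki}=N_i$ for every $i\in\{0,\ldots,n\}$. $\log$ is the natural logarithm and $\log_2$ the base-2 logarithm. Big-O is with respect to $n$ with the other parameters fixed. *)

theory Defs
  imports Complex_Main
begin

text \<open>Flows on the complete acyclic graph with vertices 0..n and edges (i,j), i<j.
  A flow is a function f :: nat => nat => nat vanishing outside {(i,j). i<j<=n};
  the net outflow at vertex i must be N i for every i in {0..n}.\<close>

definition flows :: "nat \<Rightarrow> (nat \<Rightarrow> int) \<Rightarrow> (nat \<Rightarrow> nat \<Rightarrow> nat) set" where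
  "flows n N = {f. (\<forall>i j. \<not> (i < j \<and> j \<le> n) \<longrightarrow> f i j = 0) \<and>
     (\<forall>i\<le>n. int (\<Sum>j\<in>{i<..n}. f i j) - int (\<Sum>k<i. f k i) = N i)}"

text \<open>K_n(N): the number of such integer flows (Kostant partition function of A_n).\<close>
definition K :: "nat \<Rightarrow> (nat \<Rightarrow> int) \<Rightarrow> nat" where
  "K n N = card (flows n N)"

definition extend :: "nat \<Rightarrow> (nat \<Rightarrow> int) \<Rightarrow> nat \<Rightarrow> int" where
  "extend n g i = (if i < n then g i else - (\<Sum>k<n. g k))"

end

theory Submission
  imports Defs "HOL-Library.FuncSet"
begin

text \<open>The path edges \<open>(i, i + 1)\<close> are slack variables, so \<open>K n N\<close> counts the nonnegative integer
  fillings of the other edges whose flow through every cut \<open>{0..r} | {r + 1..n}\<close> is at most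
  \<open>N 0 + \<dots> + N r\<close>. Let every vertex split a prescribed outflow arbitrarily among its \<open>m\<close>
  outgoing edges. By the cycle lemma at least a fraction \<open>1 / m\<close> of these compositions has all its
  partial sums above those of the uniform distribution, and such rows load each cut at most as much
  as the uniform ones. Hence \<open>K n N\<close> is at least a product of binomial coefficients divided by \<open>n!\<close>,
  and that product is governed by the entropy \<open>(p + 1) * ln (p + 1) - p * ln p\<close> of the uniform edge
  flows \<open>p\<close>. For (5), sets of short edges of unit flow are enough.\<close>

section \<open>Cuts and slack edges\<close>

definition cut_flow :: "nat \<Rightarrow> (nat \<Rightarrow> nat \<Rightarrow> nat) \<Rightarrow> nat \<Rightarrow> nat" where
  "cut_flow n f r = (\<Sum>i\<le>r. \<Sum>j\<in>{r<..n}. f i j)"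

text \<open>Edges inside \<open>{..r}\<close> cancel. In the induction, moving vertex
  \<open>Suc r\<close> to the left removes its incoming edges from the cut and adds its outgoing
  ones.\<close>

lemma sum_net_outflow_eq_cut:
  assumes "r \<le> n"
  shows "(\<Sum>i\<le>r. int (\<Sum>j\<in>{i<..n}. f i j) - int (\<Sum>k<i. f k i)) = int (cut_flow n f r)"
  using assms
proof (induction r)
  case 0
  then show ?case by (simp add: cut_flow_def)
next
  case (Suc r)
  have *: "{r<..n} = insert (Suc r) {Suc r<..n}"
    using Suc.prems by auto
  have "cut_flow n f r = (\<Sum>i\<le>r. f i (Suc r)) + (\<Sum>i\<le>r. \<Sum>j\<in>{Suc r<..n}. f i j)"
    by (simp add: cut_flow_def * sum.distrib)
  moreover have "cut_flow n f (Suc r) = (\<Sum>i\<le>r. \<Sum>j\<in>{Suc r<..n}. f i j) + (\<Sum>j\<in>{Suc r<..n}. f (Suc r) j)"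
    by (simp add: cut_flow_def)
  ultimately show ?case
    using Suc by (simp add: lessThan_Suc_atMost)
qed

text \<open>\<open>card\<close> of an infinite set is 0, so an injection into
  \<open>flows n N\<close> bounds \<open>K\<close> only once finiteness is known. An edge
  \<open>(i, j)\<close> carries at most the flow through cut \<open>i\<close>, and \<open>N\<close>
  fixes that.\<close>

lemma finite_flows: "finite (flows n N)"
proof -
  define S where "S = (\<Sum>r\<le>n. nat (\<Sum>i\<le>r. N i))"
  define A where "A = {p. (\<forall>e. (e \<in> {..n} \<times> {..n} \<longrightarrow> p e \<in> {..S}) \<and> (e \<notin> {..n} \<times> {..n} \<longrightarrow> p e = (0::nat)))}"
  have "finite A"
    unfolding A_def by (rule finite_set_of_finite_funs) auto
  moreover have "flows n N \<subseteq> curry ` A"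
  proof
    fix f assume f: "f \<in> flows n N"
    have le: "f i j \<le> S" if "i < j" "j \<le> n" for i j
    proof -
      have "f i j \<le> (\<Sum>j\<in>{i<..n}. f i j)"
        using that by (intro member_le_sum) auto
      also have "\<dots> \<le> cut_flow n f i"
        unfolding cut_flow_def by (rule member_le_sum[of i "{..i}" "\<lambda>k. \<Sum>j\<in>{i<..n}. f k j"]) auto
      also have "int (cut_flow n f i) = (\<Sum>k\<le>i. N k)"
        using f that by (subst sum_net_outflow_eq_cut [symmetric]) (auto simp: flows_def)
      then have "cut_flow n f i = nat (\<Sum>k\<le>i. N k)" by simp
      also have "\<dots> \<le> S"
        unfolding S_def using that
        by (intro member_le_sum[of i "{..n}" "\<lambda>r. nat (\<Sum>i\<le>r. N i)"]) auto
      finally show ?thesis .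
    qed
    have "f i j \<le> S" for i j
      using le[of i j] f by (cases "i < j \<and> j \<le> n") (auto simp: flows_def)
    moreover have "f i j = 0" if "\<not> (i \<le> n \<and> j \<le> n)" for i j
      using f that by (auto simp: flows_def)
    ultimately have "case_prod f \<in> A"
      by (auto simp: A_def)
    then show "f \<in> curry ` A"
      by (intro image_eqI[of _ _ "case_prod f"]) auto
  qed
  ultimately show ?thesis
    by (meson finite_imageI finite_subset)
qed

text \<open>The path edge \<open>(r, Suc r)\<close> crosses cut \<open>r\<close> and no other, so
  adding the missing amount \<open>d x r\<close> to it saturates this cut and leaves the others
  alone. \<open>\<Phi> x\<close> may itself use path edges, but the slack hides those values, so
  injectivity has to be visible on the remaining edges.\<close>

lemma card_le_K:
  assumes total: "(\<Sum>i\<le>n. N i) = 0"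
    and supp: "\<And>x i j. x \<in> X \<Longrightarrow> \<not> (i < j \<and> j \<le> n) \<Longrightarrow> \<Phi> x i j = 0"
    and cut: "\<And>x r. x \<in> X \<Longrightarrow> r < n \<Longrightarrow> int (cut_flow n (\<Phi> x) r) \<le> (\<Sum>i\<le>r. N i)"
    and inj: "\<And>x y. x \<in> X \<Longrightarrow> y \<in> X \<Longrightarrow> (\<And>i j. j \<noteq> Suc i \<Longrightarrow> \<Phi> x i j = \<Phi> y i j) \<Longrightarrow> x = y"
  shows "card X \<le> K n N"
proof -
  define d where "d x i = nat ((\<Sum>k\<le>i. N k) - int (cut_flow n (\<Phi> x) i))" for x i
  define \<Psi> where "\<Psi> x i j = \<Phi> x i j + (if j = Suc i \<and> j \<le> n then d x i else 0)" for x i j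
  have "inj_on \<Psi> X"
  proof (rule inj_onI)
    fix x y assume "x \<in> X" "y \<in> X" and eq: "\<Psi> x = \<Psi> y"
    show "x = y"
    proof (rule inj[OF \<open>x \<in> X\<close> \<open>y \<in> X\<close>])
      fix i j :: nat assume "j \<noteq> Suc i"
      then show "\<Phi> x i j = \<Phi> y i j"
        using fun_cong[OF fun_cong[OF eq, of i], of j] by (simp add: \<Psi>_def)
    qed
  qed
  moreover have "\<Psi> x \<in> flows n N" if x: "x \<in> X" for x
  proof -
    define net where "net i = int (\<Sum>j\<in>{i<..n}. \<Phi> x i j) - int (\<Sum>k<i. \<Phi> x k i)" for i
    have c: "(\<Sum>i\<le>r. net i) = int (cut_flow n (\<Phi> x) r)" if "r \<le> n" for r
      unfolding net_def by (rule sum_net_outflow_eq_cut[OF that])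
    have d: "int (d x r) = (\<Sum>k\<le>r. N k) - (\<Sum>k\<le>r. net k)" if "r < n" for r
      using cut[OF x that] c[of r] that by (simp add: d_def)
    \<comment> \<open>The last cut is empty. With \<open>total\<close> this settles vertex
      \<open>n\<close>, which has no outgoing slack edge.\<close>
    have top: "(\<Sum>k\<le>n. net k) = 0"
      using c[of n] by (simp add: cut_flow_def)
    have "int (\<Sum>j\<in>{i<..n}. \<Psi> x i j) - int (\<Sum>k<i. \<Psi> x k i) = N i" if i: "i \<le> n" for i
    proof -
      have "(\<Sum>j\<in>{i<..n}. \<Psi> x i j) = (\<Sum>j\<in>{i<..n}. \<Phi> x i j) + (\<Sum>j\<in>{i<..n}. if j = Suc i then d x i else 0)"
        unfolding \<Psi>_def sum.distrib by (intro arg_cong2[where f="(+)"] refl sum.cong) auto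
      then have out: "(\<Sum>j\<in>{i<..n}. \<Psi> x i j) = (\<Sum>j\<in>{i<..n}. \<Phi> x i j) + (if i < n then d x i else 0)"
        by (simp add: sum.delta)
      have "(\<Sum>k<i. \<Psi> x k i) = (\<Sum>k<i. \<Phi> x k i) + (\<Sum>k<i. if k = i - 1 then d x (i - 1) else 0)"
        unfolding \<Psi>_def sum.distrib using i by (intro arg_cong2[where f="(+)"] refl sum.cong) auto
      then have inn: "(\<Sum>k<i. \<Psi> x k i) = (\<Sum>k<i. \<Phi> x k i) + (if 0 < i then d x (i - 1) else 0)"
        by (simp add: sum.delta)
      \<comment> \<open>Outgoing and incoming slack at \<open>i\<close> are consecutive partial sums
        of \<open>N - net\<close>, so their difference is exactly the correction
        \<open>N i - net i\<close>.\<close>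
      have "(if i < n then int (d x i) else 0) = (\<Sum>k\<le>i. N k) - (\<Sum>k\<le>i. net k)"
        using d[of i] top total i by (cases "i = n") auto
      moreover have "(if 0 < i then int (d x (i - 1)) else 0) = (\<Sum>k<i. N k) - (\<Sum>k<i. net k)"
      proof (cases i)
        case (Suc l)
        then show ?thesis using d[of l] i by (simp add: lessThan_Suc_atMost)
      qed auto
      ultimately show ?thesis
        unfolding out inn using net_def[of i]
        by (auto simp: lessThan_Suc_atMost[symmetric] split: if_splits)
    qed
    then show ?thesis
      using supp[OF x] by (auto simp: flows_def \<Psi>_def)
  qed
  ultimately show ?thesis
    unfolding K_def by (intro card_inj_on_le[OF _ _ finite_flows]) auto
qed

section \<open>Cycle lemma for compositions\<close>

lemma sum_list_take_drop: "sum_list (take j xs) + sum_list (drop j xs) = sum_list xs"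
  for xs :: "'a::comm_monoid_add list"
  by (metis append_take_drop_id sum_list_append)

text \<open>The partial sums stay on or above the straight line from \<open>(0, 0)\<close> to
  \<open>(m, s)\<close>; multiplying out the denominator \<open>m\<close> keeps the condition in the
  naturals.\<close>

definition balanced :: "nat \<Rightarrow> nat \<Rightarrow> nat list set" where
  "balanced m s = {xs. length xs = m \<and> sum_list xs = s \<and> (\<forall>j\<le>m. j * s \<le> m * sum_list (take j xs))}"

text \<open>Cycle lemma: start reading at the point where the partial sums lie lowest relative to the
  straight line.\<close>
lemma balanced_rotation:
  assumes "length xs = m" "m > 0" "sum_list xs = s"
  shows "\<exists>r<m. rotate r xs \<in> balanced m s"
proof -
  define P where "P r = int (sum_list (take r xs))" for r
  define D where "D r = int m * P r - int r * int s" for r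
  define r where "r = arg_min_on D {..<m}"
  have r: "r < m" and min: "\<And>q. q < m \<Longrightarrow> D r \<le> D q"
    using arg_min_if_finite(1)[of "{..<m}" D] arg_min_least[of "{..<m}" _ D] assms
    by (auto simp: r_def)
  have rot: "rotate r xs = drop r xs @ take r xs"
    using r assms by (simp add: rotate_drop_take)
  \<comment> \<open>\<open>D\<close> is \<open>m\<close> times the height above the straight line.
    It returns to its start, so a minimum over \<open>{..<m}\<close> is a minimum over the whole
    closed walk, including prefixes that wrap around.\<close>
  have Ds: "D m = D 0"
    using assms by (simp add: D_def P_def)
  have min': "D r \<le> D q" if "q \<le> m" for q
    using min[of q] min[of 0] Ds that assms by (cases "q = m") auto
  have split: "int (sum_list (take j (drop q xs))) = P (q + j) - P q" for q j
    by (simp add: P_def take_add)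
  have "int j * int s \<le> int m * int (sum_list (take j (rotate r xs)))" if j: "j \<le> m" for j
  proof (cases "r + j \<le> m")
    case True
    then have "take j (rotate r xs) = take j (drop r xs)"
      using assms by (simp add: rot)
    then have "int m * int (sum_list (take j (rotate r xs))) = int m * P (r + j) - int m * P r"
      by (simp add: split right_diff_distrib)
    then show ?thesis
      using min'[of "r + j"] True by (simp add: D_def algebra_simps)
  next
    case False
    then have "take j (rotate r xs) = drop r xs @ take (r + j - m) xs"
      using assms j r by (simp add: rot add.commute)
    moreover have "int (sum_list (drop r xs)) = int s - P r"
      using sum_list_take_drop[of r xs] assms by (simp add: P_def)
    ultimately have e: "int (sum_list (take j (rotate r xs))) = int s - P r + P (r + j - m)"
      by (simp add: P_def)
    have "int (r + j - m) = int r + int j - int m"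
      using False by simp
    then show ?thesis
      unfolding e using min'[of "r + j - m"] False j r by (simp add: D_def algebra_simps)
  qed
  then have "\<forall>j\<le>m. j * s \<le> m * sum_list (take j (rotate r xs))"
    by (metis of_nat_mult of_nat_le_iff)
  moreover have "sum_list (rotate r xs) = s"
    using assms sum_list_take_drop[of r xs] by (simp add: rot)
  ultimately show ?thesis
    using r assms by (auto simp: balanced_def)
qed

lemma finite_lists_sum: "finite {xs::nat list. length xs = m \<and> sum_list xs = s}"
proof (rule finite_subset)
  show "{xs. length xs = m \<and> sum_list xs = s} \<subseteq> {xs. set xs \<subseteq> {..s} \<and> length xs = m}"
    using member_le_sum_list by auto
  show "finite {xs. set xs \<subseteq> {..s} \<and> length xs = m}"
    by (rule finite_lists_length_eq) auto
qed

lemma finite_balanced: "finite (balanced m s)"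
  by (rule finite_subset[OF _ finite_lists_sum[of m s]]) (auto simp: balanced_def)

text \<open>Each of the \<open>(s + m - 1) choose s\<close> compositions of \<open>s\<close> into
  \<open>m\<close> parts is one of \<open>m\<close> rotations of a balanced one.\<close>

lemma card_balanced:
  assumes "m > 0"
  shows "(s + m - 1) choose s \<le> m * card (balanced m s)"
proof -
  have "{xs. length xs = m \<and> sum_list xs = s} \<subseteq> (\<Union>q\<in>{1..m}. rotate q ` balanced m s)"
  proof safe
    fix xs :: "nat list" assume "m = length xs" "s = sum_list xs"
    with balanced_rotation[of xs m s] assms obtain r
      where r: "r < m" "rotate r xs \<in> balanced m s" by auto
    \<comment> \<open>Undoing a rotation by \<open>r < m\<close> takes a shift \<open>m - r\<close>,
      which is why the shifts range over \<open>{1..m}\<close>.\<close>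
    moreover have "xs = rotate (m - r) (rotate r xs)"
      using r \<open>m = length xs\<close> by (simp add: rotate_rotate)
    ultimately show "xs \<in> (\<Union>q\<in>{1..length xs}. rotate q ` balanced (length xs) (sum_list xs))"
      using \<open>m = length xs\<close> \<open>s = sum_list xs\<close> by (intro UN_I[of "m - r"]) auto
  qed
  then have "card {xs. length xs = m \<and> sum_list xs = s} \<le> card (\<Union>q\<in>{1..m}. rotate q ` balanced m s)"
    by (intro card_mono) (auto simp: finite_balanced)
  also have "\<dots> \<le> (\<Sum>q\<in>{1..m}. card (rotate q ` balanced m s))"
    by (rule card_UN_le) auto
  also have "\<dots> \<le> (\<Sum>q\<in>{1..m}. card (balanced m s))"
    by (intro sum_mono card_image_le finite_balanced)
  finally show ?thesis
    by (simp add: card_length_sum_list)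
qed

text \<open>Large prefixes force small tails; the tail of a row is the part that crosses a later
  cut.\<close>

lemma balanced_drop:
  assumes "xs \<in> balanced m s" "j \<le> m"
  shows "m * sum_list (drop j xs) \<le> (m - j) * s"
proof -
  have "sum_list (take j xs) + sum_list (drop j xs) = s"
    using assms sum_list_take_drop[of j xs] by (simp add: balanced_def)
  then have "m * s = m * sum_list (take j xs) + m * sum_list (drop j xs)"
    by (metis distrib_left)
  moreover have "j * s \<le> m * sum_list (take j xs)"
    using assms by (simp add: balanced_def)
  ultimately show ?thesis
    by (simp add: diff_mult_distrib)
qed

section \<open>Independent rows\<close>

text \<open>Row \<open>k\<close> lists the flows on the edges leaving vertex \<open>k\<close>. Cut
  \<open>r\<close> sees its last \<open>n - r\<close> entries, hence at most the share
  \<open>(n - r) / (n - k)\<close> of \<open>s k\<close>, so \<open>bound\<close> admits every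
  choice of balanced rows.\<close>

lemma prod_card_balanced_le_K:
  assumes total: "(\<Sum>i\<le>n. N i) = 0"
    and bound: "\<And>r. r < n \<Longrightarrow>
      real (n - r) * (\<Sum>k\<le>r. real (s k) / real (n - k)) \<le> real_of_int (\<Sum>k\<le>r. N k)"
  shows "(\<Prod>k<n. card (balanced (n - k) (s k))) \<le> K n N"
proof -
  define X where "X = (\<Pi>\<^sub>E k\<in>{..<n}. balanced (n - k) (s k))"
  define \<Phi> where "\<Phi> x k j = (if k < j \<and> j \<le> n then x k ! (j - k - 1) else 0)"
    for x :: "nat \<Rightarrow> nat list" and k j
  have row: "x k \<in> balanced (n - k) (s k)" if "x \<in> X" "k < n" for x k
    using that by (auto simp: X_def)
  have "card X \<le> K n N"
  proof (rule card_le_K[OF total])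
    show "\<Phi> x i j = 0" if "\<not> (i < j \<and> j \<le> n)" for x i j
      using that by (auto simp: \<Phi>_def)
  next
    fix x r assume x: "x \<in> X" and r: "r < n"
    have "real (\<Sum>j\<in>{r<..n}. \<Phi> x k j) \<le> real (n - r) * (real (s k) / real (n - k))"
      if k: "k \<le> r" for k
    proof -
      have b: "x k \<in> balanced (n - k) (s k)"
        using row x k r by simp
      have "(\<Sum>j\<in>{r<..n}. \<Phi> x k j) = (\<Sum>i\<in>{0..<n - r}. x k ! (r - k + i))"
        using k r by (intro sum.reindex_bij_witness[of _ "\<lambda>i. i + r + 1" "\<lambda>j. j - r - 1"])
          (auto simp: \<Phi>_def intro!: arg_cong[where f="nth (x k)"])
      also have "\<dots> = sum_list (drop (r - k) (x k))"
        using b k r by (simp add: sum_list_sum_nth balanced_def)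
      finally have "(n - k) * (\<Sum>j\<in>{r<..n}. \<Phi> x k j) \<le> (n - r) * s k"
        using balanced_drop[OF b, of "r - k"] k r by simp
      then have "real (n - k) * real (\<Sum>j\<in>{r<..n}. \<Phi> x k j) \<le> real (n - r) * real (s k)"
        by (metis of_nat_le_iff of_nat_mult)
      then show ?thesis
        using k r by (simp add: pos_le_divide_eq mult.commute)
    qed
    then have "real (cut_flow n (\<Phi> x) r) \<le> (\<Sum>k\<le>r. real (n - r) * (real (s k) / real (n - k)))"
      unfolding cut_flow_def of_nat_sum[where A="{..r}"] by (intro sum_mono) simp
    also have "\<dots> \<le> real_of_int (\<Sum>k\<le>r. N k)"
      using bound[OF r] by (simp add: sum_distrib_left)
    finally show "int (cut_flow n (\<Phi> x) r) \<le> (\<Sum>k\<le>r. N k)"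
      by linarith
  next
    fix x y assume x: "x \<in> X" and y: "y \<in> X"
      and eq: "\<And>i j. j \<noteq> Suc i \<Longrightarrow> \<Phi> x i j = \<Phi> y i j"
    show "x = y"
    proof (rule PiE_ext[OF x[unfolded X_def] y[unfolded X_def]])
      fix k assume "k \<in> {..<n}"
      then have k: "k < n" by simp
      have lx: "length (x k) = n - k" "sum_list (x k) = s k"
        and ly: "length (y k) = n - k" "sum_list (y k) = s k"
        using row[OF x k] row[OF y k] by (auto simp: balanced_def)
      \<comment> \<open>The head of a row sits on a path edge and is invisible to \<open>eq\<close>;
        the prescribed row sum recovers it from the tail.\<close>
      have "tl (x k) = tl (y k)"
      proof (rule nth_equalityI)
        fix i assume i: "i < length (tl (x k))"
        then have "k + i + 2 \<le> n" "i < length (tl (y k))"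
          using lx ly by auto
        moreover have "k + i + 2 - k - 1 = Suc i" by simp
        ultimately show "tl (x k) ! i = tl (y k) ! i"
          using eq[of "k + i + 2" k] i by (simp add: \<Phi>_def nth_tl del: diff_diff_left)
      qed (use lx ly in simp)
      then show "x k = y k"
        using lx ly k by (cases "x k"; cases "y k") auto
    qed
  qed
  then show ?thesis
    by (simp add: X_def card_PiE)
qed

section \<open>Logarithm and entropy inequalities\<close>

text \<open>These are the first two terms of the series of \<open>2 * artanh x\<close>; the
  remainder has derivative \<open>2 * y ^ 4 / (1 - y ^ 2)\<close>.\<close>

lemma ln_quotient_ge:
  fixes x :: real
  assumes "0 \<le> x" "x < 1"
  shows "2 * x + 2 * x ^ 3 / 3 \<le> ln ((1 + x) / (1 - x))"
proof -
  let ?f = "\<lambda>x::real. ln (1 + x) - ln (1 - x) - 2 * x - 2 * x ^ 3 / 3"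
  have "?f 0 \<le> ?f x"
  proof (rule DERIV_nonneg_imp_nondecreasing[OF assms(1)])
    fix y assume y: "0 \<le> y" "y \<le> x"
    then have y1: "y < 1" using assms by simp
    have "(?f has_real_derivative 1 / (1 + y) + 1 / (1 - y) - 2 - 2 * y ^ 2) (at y)"
      using y y1 by (auto intro!: derivative_eq_intros)
    moreover have "1 / (1 + y) + 1 / (1 - y) - 2 - 2 * y ^ 2 = 2 * y ^ 4 / ((1 + y) * (1 - y))"
      using y y1 by (simp add: divide_simps) (simp add: algebra_simps power2_eq_square power4_eq_xxxx)
    moreover have "2 * y ^ 4 / ((1 + y) * (1 - y)) \<ge> 0"
      using y y1 by simp
    ultimately show "\<exists>D. (?f has_real_derivative D) (at y) \<and> 0 \<le> D"
      by auto
  qed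
  then show ?thesis
    using assms by (simp add: ln_div)
qed

text \<open>The linear term of the same series, at \<open>e = (y - x) / (y + x)\<close>.\<close>

lemma ln_divide_ge:
  fixes x y :: real
  assumes "0 < x" "x \<le> y"
  shows "2 * (y - x) / (y + x) \<le> ln (y / x)"
proof -
  define e where "e = (y - x) / (y + x)"
  have e: "0 \<le> e" "e < 1" using assms by (auto simp: e_def divide_simps)
  have "1 + e = 2 * y / (y + x)" "1 - e = 2 * x / (y + x)"
    using assms by (auto simp: e_def field_simps)
  then have "(1 + e) / (1 - e) = y / x"
    using assms by simp
  moreover have "2 * e \<le> ln ((1 + e) / (1 - e))"
    using ln_quotient_ge[OF e] e by (smt (verit) divide_nonneg_nonneg zero_le_power)
  ultimately show ?thesis by (simp add: e_def)
qed

text \<open>The entropy, in nats, of the geometric distribution on the naturals with mean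
  \<open>p\<close>. It is the growth rate per part of the number of compositions of
  \<open>m * p\<close> into \<open>m\<close> parts.\<close>

definition geom_entropy :: "real \<Rightarrow> real" where
  "geom_entropy p = (p + 1) * ln (p + 1) - p * ln p"

lemma DERIV_geom_entropy:
  assumes "p > 0"
  shows "(geom_entropy has_real_derivative ln (p + 1) - ln p) (at p)"
  unfolding geom_entropy_def using assms by (auto intro!: derivative_eq_intros)

lemma geom_entropy_nonneg:
  assumes "p \<ge> 0"
  shows "geom_entropy p \<ge> 0"
proof (cases "p = 0")
  case False
  then have "p * ln p \<le> p * ln (p + 1)" using assms by (intro mult_left_mono) auto
  also have "\<dots> \<le> (p + 1) * ln (p + 1)" using assms by (intro mult_right_mono) auto
  finally show ?thesis by (simp add: geom_entropy_def)
qed (simp add: geom_entropy_def)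

lemma geom_entropy_mono:
  assumes "0 \<le> p" "p \<le> q"
  shows "geom_entropy p \<le> geom_entropy q"
\<comment> \<open>The derivative blows up at 0, so that endpoint is handled by
  nonnegativity.\<close>
proof (cases "p = 0")
  case True
  then show ?thesis
    using assms geom_entropy_nonneg[of q] by (simp add: geom_entropy_def)
next
  case False
  show ?thesis
  proof (rule DERIV_nonneg_imp_nondecreasing[OF assms(2)])
    fix x assume "p \<le> x"
    with False assms have "x > 0" by simp
    then show "\<exists>D. (geom_entropy has_real_derivative D) (at x) \<and> 0 \<le> D"
      by (intro exI[of _ "ln (x + 1) - ln x"] conjI DERIV_geom_entropy) auto
  qed
qed

text \<open>Follows from \<open>ln (1 + 1 / p) >= 1 / (p + 1)\<close>; the gap vanishes as
  \<open>p\<close> grows.\<close>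

lemma geom_entropy_ge_ln:
  assumes "p > 0"
  shows "geom_entropy p \<ge> 1 + ln p"
proof -
  have "ln (p / (p + 1)) \<le> p / (p + 1) - 1"
    using assms by (intro ln_le_minus_one) auto
  then have "1 / (p + 1) \<le> ln (p + 1) - ln p"
    using assms by (simp add: ln_div field_simps)
  then have "1 \<le> (p + 1) * (ln (p + 1) - ln p)"
    using assms by (simp add: field_simps)
  then show ?thesis by (simp add: geom_entropy_def algebra_simps)
qed

text \<open>The difference of the two sides is nondecreasing and tends to \<open>0\<close> at \<open>0\<close>.\<close>
lemma geom_entropy_ge_ln_two:
  assumes "p \<ge> 0"
  shows "geom_entropy p \<ge> ln (2 * p + 1)"
proof (cases "p = 0")
  case False
  let ?f = "\<lambda>x. geom_entropy x - ln (2 * x + 1)"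
  have mono: "?f q \<le> ?f p" if q: "0 < q" "q \<le> p" for q
  proof (rule DERIV_nonneg_imp_nondecreasing[OF q(2)])
    fix x assume "q \<le> x"
    with q have x: "x > 0" by simp
    then have "(?f has_real_derivative ln (x + 1) - ln x - 2 / (2 * x + 1)) (at x)"
      by (auto intro!: derivative_eq_intros DERIV_geom_entropy)
    moreover have "0 \<le> ln (x + 1) - ln x - 2 / (2 * x + 1)"
      using ln_divide_ge[of x "x + 1"] x by (simp add: ln_div)
    ultimately show "\<exists>D. (?f has_real_derivative D) (at x) \<and> 0 \<le> D" by blast
  qed
  have "- ?f p \<le> 0 + e" if "e > 0" for e
  proof -
    \<comment> \<open>Replaces the limit at 0: \<open>?f q\<close> is at least
      \<open>- ln (2 * q + 1)\<close>, hence at least \<open>- 2 * q\<close> and so at least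
      \<open>- e\<close>.\<close>
    define q where "q = min (e / 2) p"
    have q: "0 < q" "q \<le> p" "2 * q \<le> e"
      using that False assms by (auto simp: q_def)
    have "ln (2 * q + 1) \<le> 2 * q"
      using ln_add_one_self_le_self[of "2 * q"] q by (simp add: add.commute)
    then show ?thesis
      using mono[OF q(1,2)] geom_entropy_nonneg[of q] q by linarith
  qed
  then have "- ?f p \<le> 0"
    by (rule field_le_epsilon)
  then show ?thesis by simp
qed (simp add: geom_entropy_def)

text \<open>The expansion begins \<open>2 * e - e ^ 3 / 3\<close>; raising \<open>1 / 3\<close> to
  \<open>2 / 5\<close> absorbs the higher terms, because \<open>- ln (1 - z) <= 6 / 5 * z\<close>
  for \<open>z <= 1 / 9\<close>.\<close>

lemma odd_entropy_ge:
  fixes e :: real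
  assumes "0 \<le> e" "e \<le> 1 / 3"
  shows "2 * e - 2 / 5 * e ^ 3 \<le> (1 + e) * ln (1 + e) - (1 - e) * ln (1 - e)"
proof -
  let ?f = "\<lambda>e::real. (1 + e) * ln (1 + e) - (1 - e) * ln (1 - e) - 2 * e + 2 / 5 * e ^ 3"
  have "?f 0 \<le> ?f e"
  proof (rule DERIV_nonneg_imp_nondecreasing[OF assms(1)])
    fix y assume y: "0 \<le> y" "y \<le> e"
    then have y3: "y \<le> 1 / 3" using assms by simp
    have "(?f has_real_derivative ln (1 + y) + ln (1 - y) + 6 / 5 * y ^ 2) (at y)"
      using y y3 by (auto intro!: derivative_eq_intros)
    moreover have "0 \<le> ln (1 + y) + ln (1 - y) + 6 / 5 * y ^ 2"
    proof -
      define z where "z = y ^ 2"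
      have "y ^ 2 \<le> (1 / 3) ^ 2"
        using y y3 by (intro power_mono) auto
      then have z: "0 \<le> z" "z \<le> 1 / 9"
        by (auto simp: z_def power2_eq_square)
      have "ln (1 / (1 - z)) \<le> 1 / (1 - z) - 1"
        using z by (intro ln_le_minus_one) auto
      also have "\<dots> \<le> 6 / 5 * z"
      proof -
        have "1 \<le> (1 + 6 / 5 * z) * (1 - z)"
        proof -
          have "z * (1 / 5 - 6 / 5 * z) \<ge> 0" using z by (intro mult_nonneg_nonneg) auto
          then show ?thesis by (simp add: algebra_simps)
        qed
        then have "1 / (1 - z) \<le> 1 + 6 / 5 * z" using z by (subst pos_divide_le_eq) auto
        then show ?thesis by simp
      qed
      finally have "- ln (1 - z) \<le> 6 / 5 * z" using z by (simp add: ln_div)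
      moreover have "ln (1 + y) + ln (1 - y) = ln (1 - z)"
        using y y3 ln_mult[of "1 + y" "1 - y"] by (simp add: z_def algebra_simps power2_eq_square)
      ultimately show ?thesis by (simp add: z_def)
    qed
    ultimately show "\<exists>D. (?f has_real_derivative D) (at y) \<and> 0 \<le> D"
      by auto
  qed
  then show ?thesis by simp
qed

text \<open>Expanding around the midpoint \<open>M\<close> of \<open>p\<close> and
  \<open>p + 1\<close> removes the term of order \<open>1 / M\<close>. The error is the cubic term
  of \<open>odd_entropy_ge\<close> at \<open>e = 1 / (2 * M)\<close>, and \<open>M >= 3 / 2\<close>
  means \<open>e <= 1 / 3\<close>.\<close>

lemma geom_entropy_shift_ge:
  assumes "M \<ge> 3 / 2"
  shows "geom_entropy (M - 1 / 2) \<ge> 1 + ln M - 1 / (20 * M ^ 2)"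
proof -
  define e where "e = 1 / (2 * M)"
  have e: "0 < e" "e \<le> 1 / 3" using assms by (auto simp: e_def divide_simps)
  have M: "M = 1 / (2 * e)" "M > 0" using assms by (auto simp: e_def)
  have 1: "M + 1 / 2 = M * (1 + e)" "M - 1 / 2 = M * (1 - e)"
    using assms by (auto simp: e_def algebra_simps)
  have "geom_entropy (M - 1 / 2) = (M + 1 / 2) * ln (M + 1 / 2) - (M - 1 / 2) * ln (M - 1 / 2)"
    by (simp add: geom_entropy_def add.commute)
  also have "\<dots> = M * (1 + e) * (ln M + ln (1 + e)) - M * (1 - e) * (ln M + ln (1 - e))"
    using M(2) e unfolding 1 by (simp add: ln_mult)
  also have "\<dots> = 2 * M * e * ln M + M * ((1 + e) * ln (1 + e) - (1 - e) * ln (1 - e))"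
    by (simp add: algebra_simps)
  also have "\<dots> \<ge> 2 * M * e * ln M + M * (2 * e - 2 / 5 * e ^ 3)"
    using odd_entropy_ge[of e] e M by (intro add_left_mono mult_left_mono) auto
  also have "2 * M * e * ln M + M * (2 * e - 2 / 5 * e ^ 3) = 1 + ln M - 1 / (20 * M ^ 2)"
    using M by (simp add: e_def field_simps power2_eq_square power3_eq_cube)
  finally show ?thesis .
qed

section \<open>Binomial coefficients and the entropy\<close>

lemma ln_fact_Suc: "ln (fact (Suc n)) = ln (fact n) + ln (real n + 1)"
  by (simp add: ln_mult add.commute del: of_nat_Suc)

text \<open>Stirling up to polynomial factors suffices. The induction step here is
  \<open>n * ln (1 + 1 / n) <= 1\<close>, and for the upper bound
  \<open>(n + 1) * ln (1 + 1 / n) >= 1\<close>.\<close>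

lemma ln_fact_ge: "real n * ln (real n) - real n \<le> ln (fact n)"
proof (induction n)
  case (Suc n)
  show ?case
  proof (cases "n = 0")
    case False
    have "ln ((real n + 1) / real n) \<le> (real n + 1) / real n - 1"
      using False by (intro ln_le_minus_one) auto
    then have "real n * (ln (real n + 1) - ln (real n)) \<le> 1"
      using False by (simp add: ln_div field_simps)
    then show ?thesis
      using Suc unfolding ln_fact_Suc by (simp add: algebra_simps)
  qed simp
qed simp

lemma ln_fact_le:
  assumes "n > 0"
  shows "ln (fact n) \<le> (real n + 1) * ln (real n) - real n + 1"
  using assms
proof (induction n rule: nat_induct_non_zero)
  case (Suc n)
  have "ln (real n / (real n + 1)) \<le> real n / (real n + 1) - 1"
    using Suc.hyps by (intro ln_le_minus_one) auto
  then have "1 \<le> (real n + 1) * (ln (real n + 1) - ln (real n))"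
    using Suc.hyps by (simp add: ln_div field_simps)
  then show ?case
    using Suc unfolding ln_fact_Suc by (simp add: algebra_simps)
qed simp

text \<open>The factorials of \<open>s + 1\<close>, \<open>m\<close> and \<open>s + 1 + m\<close>
  are compared instead of those in the binomial. The factors \<open>s + 1\<close> and
  \<open>m\<close> gained this way cancel the surplus logarithms of \<open>ln_fact_le\<close>; the
  two factors of the large factorial cost \<open>2 * ln (u + real m)\<close>.\<close>

lemma ln_choose_ge:
  fixes m s :: nat
  assumes "m > 0"
  defines "u \<equiv> real s + 1"
  shows "real m * geom_entropy (u / real m) - 2 - 2 * ln (u + real m) \<le> ln (real ((s + m - 1) choose s))"
proof -
  obtain l where l: "m = Suc l" using assms by (cases m) auto
  have u: "u > 0" "u = real (Suc s)" by (auto simp: u_def)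
  have "real ((s + m - 1) choose s) = fact (s + l) / (fact s * fact l)"
    by (simp add: l binomial_fact)
  then have A: "ln (real ((s + m - 1) choose s)) = ln (fact (s + l)) - ln (fact s) - ln (fact l)"
    by (simp add: ln_div ln_mult)
  have B: "ln (fact (Suc s + m)) = ln (fact (s + l)) + ln (u + real m) + ln (real s + real l + 1)"
    using ln_fact_Suc[of "s + l"] ln_fact_Suc[of "Suc (s + l)"]
    by (simp add: l u_def algebra_simps del: fact_Suc)
  have C: "ln (fact (Suc s)) = ln (fact s) + ln u" "ln (fact m) = ln (fact l) + ln (real m)"
    using ln_fact_Suc[of s] ln_fact_Suc[of l] by (simp_all add: u_def l add.commute del: fact_Suc)
  have D: "ln (real s + real l + 1) \<le> ln (u + real m)"
    using u by (simp add: l u_def)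
  have "(u + real m) * ln (u + real m) - (u + real m) \<le> ln (fact (Suc s + m))"
    using ln_fact_ge[of "Suc s + m"] by (simp add: u_def algebra_simps)
  moreover have "ln (fact (Suc s)) \<le> (u + 1) * ln u - u + 1"
    using ln_fact_le[of "Suc s"] by (simp add: u_def algebra_simps)
  moreover have "ln (fact m) \<le> (real m + 1) * ln (real m) - real m + 1"
    using ln_fact_le[OF assms(1)] by simp
  moreover have "real m * geom_entropy (u / real m)
      = (u + real m) * ln (u + real m) - u * ln u - real m * ln (real m)"
  proof -
    have "u / real m + 1 = (u + real m) / real m" using assms by (simp add: field_simps)
    then have "real m * geom_entropy (u / real m)
      = (u + real m) * (ln (u + real m) - ln (real m)) - u * (ln u - ln (real m))"
      using assms u by (simp add: geom_entropy_def ln_div right_diff_distrib)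
    then show ?thesis by (simp add: algebra_simps)
  qed
  ultimately show ?thesis
    using A B C D by (simp add: algebra_simps)
qed

lemma card_balanced_ge:
  assumes "m > 0" "p \<ge> 0" "real m * p + real m + 2 \<le> Q"
  shows "exp (real m * geom_entropy p - 5 * ln Q) \<le> real (card (balanced m (nat \<lfloor>real m * p\<rfloor>)))"
proof -
  define s where "s = nat \<lfloor>real m * p\<rfloor>"
  have mp: "0 \<le> real m * p" using assms by simp
  have s: "real s \<le> real m * p" "real m * p \<le> real s + 1"
    using mp by (auto simp: s_def)
  have Q3: "3 \<le> Q" using assms mp by linarith
  have "exp 1 \<le> Q" using exp_le Q3 by linarith
  then have Q1: "1 \<le> ln Q" using Q3 by (simp add: ln_ge_iff)
  have mQ: "ln (real m) \<le> ln Q" "ln (real s + 1 + real m) \<le> ln Q"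
    using assms s mp by auto
  \<comment> \<open>Rounding \<open>m * p\<close> down is harmless: the binomial bound is in terms
    of \<open>s + 1\<close>, and the entropy is monotone.\<close>
  have "p \<le> (real s + 1) / real m"
    using s assms by (simp add: pos_le_divide_eq mult.commute)
  then have "real m * geom_entropy p \<le> real m * geom_entropy ((real s + 1) / real m)"
    using assms by (intro mult_left_mono geom_entropy_mono) auto
  also have "\<dots> \<le> ln (real ((s + m - 1) choose s)) + 2 + 2 * ln (real s + 1 + real m)"
    using ln_choose_ge[OF assms(1), of s] by simp
  \<comment> \<open>Of the five copies of \<open>ln Q\<close>, two pay for the logarithms, one for
    the division by \<open>m\<close> and two for the constant 2.\<close>
  finally have "real m * geom_entropy p - 5 * ln Q + ln (real m) \<le> ln (real ((s + m - 1) choose s))"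
    using mQ Q1 by linarith
  moreover have "0 < (s + m - 1) choose s" using assms by simp
  ultimately have "exp (real m * geom_entropy p - 5 * ln Q + ln (real m)) \<le> real ((s + m - 1) choose s)"
    by (subst (asm) ln_ge_iff) auto
  also have "\<dots> \<le> real m * real (card (balanced m s))"
    using card_balanced[OF assms(1), of s] by (metis of_nat_le_iff of_nat_mult)
  finally have "real m * exp (real m * geom_entropy p - 5 * ln Q) \<le> real m * real (card (balanced m s))"
    using assms by (simp add: exp_add mult.commute)
  then show ?thesis using assms by (simp add: s_def)
qed

section \<open>Uniform splitting with quadratic partial sums\<close>

text \<open>The flow along each of the \<open>m\<close> outgoing edges of vertex \<open>n - m\<close> when every vertex splits its
  outflow uniformly and the net outflows have partial sums \<open>(r + 1) * (b * n - c * (n - r))\<close>.\<close>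
definition spread :: "real \<Rightarrow> real \<Rightarrow> nat \<Rightarrow> nat \<Rightarrow> real" where
  "spread b c n m = b * (real n * (real n + 1) / (real m * (real m + 1))) - c"

text \<open>Under uniform splitting each vertex beyond \<open>r\<close> receives the sum of the edge
  flows of vertices \<open>0..r\<close>, so this sum is the capacity of cut \<open>r\<close> divided
  by \<open>n - r\<close>. Taking differences in \<open>r\<close> gives \<open>spread\<close>, since
  \<open>(r + 1) * (n - r + 1) - r * (n - r) = n + 1\<close>.\<close>

lemma sum_spread:
  assumes "r < n"
  shows "real (n - r) * (\<Sum>k\<le>r. spread b c n (n - k)) = (real r + 1) * (b * real n - c * real (n - r))"
  using assms
proof (induction r)
  case 0
  have "real n + 1 \<noteq> 0" by linarith
  with 0 have "real n * (real n + 1) / (real n * (real n + 1)) = 1"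
    by (intro divide_self) auto
  then have "spread b c n n = b - c"
    unfolding spread_def by (simp only: mult_1_right)
  then show ?case by (simp add: left_diff_distrib mult.commute[of "real n"])
next
  case (Suc r)
  define m where "m = real (n - Suc r)"
  have m: "m > 0" "real (n - r) = m + 1" "real n = m + real r + 1"
    using Suc.prems by (auto simp: m_def)
  have "(\<Sum>k\<le>r. spread b c n (n - k)) = (real r + 1) * (b * real n - c * (m + 1)) / (m + 1)"
    using Suc m by (simp add: field_simps)
  moreover have "spread b c n (n - Suc r) = b * (real n * (real n + 1) / (m * (m + 1))) - c"
    by (simp add: spread_def m_def)
  ultimately have "m * (\<Sum>k\<le>Suc r. spread b c n (n - k))
      = m * ((real r + 1) * (b * real n - c * (m + 1)) / (m + 1))
        + m * (b * (real n * (real n + 1) / (m * (m + 1))) - c)"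
    by (simp add: distrib_left)
  also have "\<dots> = (real (Suc r) + 1) * (b * real n - c * m)"
    using m(1) by (simp add: m(3) divide_simps) (simp add: algebra_simps)
  finally show ?case by (simp add: m_def)
qed

text \<open>The uniform flow exhausts every cut exactly, so rows with the rounded-down outflows fit.
  Each of the \<open>n\<close> rows loses a factor of at most \<open>Q ^ 5\<close>.\<close>

lemma K_ge_exp_spread:
  assumes total: "(\<Sum>i\<le>n. N i) = 0"
    and partial: "\<And>r. r < n \<Longrightarrow>
      real_of_int (\<Sum>k\<le>r. N k) = (real r + 1) * (b * real n - c * real (n - r))"
    and nonneg: "\<And>m. 0 < m \<Longrightarrow> m \<le> n \<Longrightarrow> 0 \<le> spread b c n m"
    and Q: "\<And>m. 0 < m \<Longrightarrow> m \<le> n \<Longrightarrow> real m * spread b c n m + real m + 2 \<le> Q"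
  shows "exp ((\<Sum>m=1..n. real m * geom_entropy (spread b c n m)) - 5 * real n * ln Q) \<le> real (K n N)"
proof -
  define s where "s k = nat \<lfloor>real (n - k) * spread b c n (n - k)\<rfloor>" for k
  have "(\<Sum>m=1..n. real m * geom_entropy (spread b c n m)) - 5 * real n * ln Q
      = (\<Sum>m=1..n. real m * geom_entropy (spread b c n m) - 5 * ln Q)"
    by (simp add: sum_subtractf)
  also have "\<dots> = (\<Sum>k<n. real (n - k) * geom_entropy (spread b c n (n - k)) - 5 * ln Q)"
    by (rule sum.reindex_bij_witness[of _ "\<lambda>k. n - k" "\<lambda>m. n - m"]) auto
  finally have "exp ((\<Sum>m=1..n. real m * geom_entropy (spread b c n m)) - 5 * real n * ln Q)
      = (\<Prod>k<n. exp (real (n - k) * geom_entropy (spread b c n (n - k)) - 5 * ln Q))"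
    by (simp add: exp_sum)
  also have "\<dots> \<le> (\<Prod>k<n. real (card (balanced (n - k) (s k))))"
    unfolding s_def by (intro prod_mono conjI card_balanced_ge nonneg Q) auto
  also have "\<dots> = real (\<Prod>k<n. card (balanced (n - k) (s k)))"
    by simp
  also have "(\<Prod>k<n. card (balanced (n - k) (s k))) \<le> K n N"
  proof (rule prod_card_balanced_le_K[OF total])
    fix r assume r: "r < n"
    have "(\<Sum>k\<le>r. real (s k) / real (n - k)) \<le> (\<Sum>k\<le>r. spread b c n (n - k))"
    proof (rule sum_mono)
      fix k assume "k \<in> {..r}"
      then have k: "0 < n - k" "n - k \<le> n" using r by auto
      have "real (s k) \<le> real (n - k) * spread b c n (n - k)"
        using nonneg[OF k] unfolding s_def by (intro of_nat_floor mult_nonneg_nonneg) auto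
      then show "real (s k) / real (n - k) \<le> spread b c n (n - k)"
        using k by (simp add: pos_divide_le_eq mult.commute)
    qed
    then have "real (n - r) * (\<Sum>k\<le>r. real (s k) / real (n - k))
        \<le> real (n - r) * (\<Sum>k\<le>r. spread b c n (n - k))"
      by (intro mult_left_mono) auto
    then show "real (n - r) * (\<Sum>k\<le>r. real (s k) / real (n - k)) \<le> real_of_int (\<Sum>k\<le>r. N k)"
      using sum_spread[OF r] partial[OF r] by simp
  qed
  finally show ?thesis by simp
qed

text \<open>\<open>Q = n ^ 3\<close> is eventually large enough, and five logarithms of it make 15.
  The conditions on \<open>N n\<close> stay under the quantifier since a family may meet them only
  for some \<open>n\<close>, such as those with \<open>a * n\<close> integral.\<close>

lemma eventually_K_ge_spread:
  fixes N :: "nat \<Rightarrow> nat \<Rightarrow> int"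
  shows "\<forall>\<^sub>F n in sequentially.
    (\<Sum>i\<le>n. N n i) = 0 \<longrightarrow>
    (\<forall>r<n. real_of_int (\<Sum>k\<le>r. N n k) = (real r + 1) * (b * real n - c * real (n - r))) \<longrightarrow>
    (\<forall>m. 0 < m \<longrightarrow> m \<le> n \<longrightarrow> 0 \<le> spread b c n m) \<longrightarrow>
    exp ((\<Sum>m=1..n. real m * geom_entropy (spread b c n m)) - 15 * real n * ln (real n))
      \<le> real (K n (N n))"
proof -
  define B where "B = \<bar>b\<bar>"
  define D where "D = \<bar>c\<bar>"
  have "\<forall>\<^sub>F n in sequentially. B * real n * (real n + 1) + D * real n + real n + 2 \<le> real n ^ 3"
    using eventually_ge_at_top[of "nat \<lceil>2 * B + D + 3\<rceil>"] eventually_gt_at_top[of 0]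
  proof eventually_elim
    case (elim n)
    then have n: "real n \<ge> 2 * B + D + 3" "1 \<le> real n" by linarith+
    have sq: "real n \<le> real n * real n" "1 \<le> real n * real n"
      using n(2) mult_mono[of 1 "real n" 1 "real n"] mult_right_mono[of 1 "real n" "real n"] by simp_all
    have "B * real n \<le> B * (real n * real n)" "D * real n \<le> D * (real n * real n)"
      using sq by (auto intro!: mult_left_mono simp: B_def D_def)
    \<comment> \<open>For \<open>n >= 1\<close> the left side of the goal is at most
      \<open>(2 * B + D + 3) * n ^ 2\<close>.\<close>
    moreover have "(2 * B + D + 3) * (real n * real n) \<le> real n * (real n * real n)"
      using n by (intro mult_right_mono) auto
    ultimately show ?case
      using sq by (simp add: algebra_simps power3_eq_cube)
  qed
  then show ?thesis
    using eventually_gt_at_top[of 0]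
  proof eventually_elim
    case (elim n)
    have le: "real m * spread b c n m + real m + 2 \<le> real n ^ 3" if "0 < m" "m \<le> n" for m
    proof -
      have m: "real m > 0" "real m \<le> real n" using that by auto
      have "real m * spread b c n m = b * real n * (real n + 1) / (real m + 1) - c * real m"
      proof -
        have "x * (b * (y / (x * z)) - c) = b * y / z - c * x" if "x > 0" for x y z :: real
          using that by (simp add: right_diff_distrib mult.commute)
        from this[OF m(1)] show ?thesis by (simp add: spread_def mult.assoc)
      qed
      moreover have "b * real n * (real n + 1) / (real m + 1) \<le> B * real n * (real n + 1)"
      proof -
        have "b * real n * (real n + 1) / (real m + 1) \<le> B * real n * (real n + 1) / (real m + 1)"
          by (intro divide_right_mono mult_right_mono) (auto simp: B_def)
        also have "\<dots> \<le> B * real n * (real n + 1) / 1"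
          by (intro divide_left_mono) (auto simp: B_def)
        finally show ?thesis by simp
      qed
      moreover have "- c * real m \<le> D * real n"
        using m by (intro mult_mono) (auto simp: D_def)
      ultimately show ?thesis
        using elim m by simp
    qed
    show ?case
    proof (intro impI)
      assume "(\<Sum>i\<le>n. N n i) = 0"
        "\<forall>r<n. real_of_int (\<Sum>k\<le>r. N n k) = (real r + 1) * (b * real n - c * real (n - r))"
        "\<forall>m. 0 < m \<longrightarrow> m \<le> n \<longrightarrow> 0 \<le> spread b c n m"
      then have "exp ((\<Sum>m=1..n. real m * geom_entropy (spread b c n m)) - 5 * real n * ln (real n ^ 3))
          \<le> real (K n (N n))"
        using le by (intro K_ge_exp_spread) auto
      then show "exp ((\<Sum>m=1..n. real m * geom_entropy (spread b c n m)) - 15 * real n * ln (real n))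
          \<le> real (K n (N n))"
        by (simp add: ln_realpow mult.assoc)
    qed
  qed
qed

section \<open>Summing the entropies\<close>

lemma sum_real_upto: "(\<Sum>m=1..n. real m) = real n * (real n + 1) / 2"
  by (induction n) (auto simp: field_simps)

text \<open>Passing to \<open>n + 1\<close> adds \<open>ln ((n + 2) / n) >= 2 / (n + 1)\<close> to
  each old logarithm, a gain of at least \<open>n\<close> after weighting, and the new term is
  \<open>ln 1\<close>.\<close>

lemma sum_ln_quotient_ge:
  "(\<Sum>m=1..n. real m * ln (real n * (real n + 1) / (real m * (real m + 1)))) \<ge> real n * (real n - 1) / 2"
proof (induction n)
  case (Suc n)
  show ?case
  proof (cases "n = 0")
    case False
    define L where "L = ln ((real n + 2) / real n)"
    let ?S = "\<Sum>m=1..n. real m * ln (real n * (real n + 1) / (real m * (real m + 1)))"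
    have "real m * ln (real (Suc n) * (real (Suc n) + 1) / (real m * (real m + 1)))
        = real m * ln (real n * (real n + 1) / (real m * (real m + 1))) + L * real m"
      if "m \<in> {1..n}" for m
    proof -
      have "(real n + 1) * (real n + 2) / d = (real n * (real n + 1) / d) * ((real n + 2) / real n)" for d
        using False by simp
      moreover have "real (Suc n) * (real (Suc n) + 1) = (real n + 1) * (real n + 2)"
        by (simp add: algebra_simps)
      ultimately have "real (Suc n) * (real (Suc n) + 1) / (real m * (real m + 1))
          = (real n * (real n + 1) / (real m * (real m + 1))) * ((real n + 2) / real n)"
        by simp
      moreover have "real n * (real n + 1) / (real m * (real m + 1)) > 0" "(real n + 2) / real n > 0"
        using False that by auto
      ultimately show ?thesis
        by (simp only: ln_mult_pos L_def distrib_left mult.commute)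
    qed
    then have "(\<Sum>m=1..Suc n. real m * ln (real (Suc n) * (real (Suc n) + 1) / (real m * (real m + 1))))
        = ?S + L * (\<Sum>m=1..n. real m)"
      by (simp add: sum.distrib sum_distrib_left)
    moreover have "real n \<le> L * (\<Sum>m=1..n. real m)"
    proof -
      have "2 / (real n + 1) \<le> L"
      proof -
        have "2 * (real n + 2 - real n) / (real n + 2 + real n) = 2 / (real n + 1)"
          by (simp add: divide_simps)
        then show ?thesis
          using ln_divide_ge[of "real n" "real n + 2"] False by (simp add: L_def)
      qed
      then have "2 / (real n + 1) * (\<Sum>m=1..n. real m) \<le> L * (\<Sum>m=1..n. real m)"
        by (intro mult_right_mono sum_nonneg) auto
      moreover have "2 / (real n + 1) * (\<Sum>m=1..n. real m) = real n"
        unfolding sum_real_upto by (simp add: add_nonneg_eq_0_iff)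
      ultimately show ?thesis by simp
    qed
    ultimately show ?thesis
      using Suc by (simp add: field_simps)
  qed simp
qed simp

text \<open>The shared assembly: a pointwise bound with constant \<open>w\<close> yields the leading
  coefficient \<open>(w + 1) / 2\<close>, up to the weighted errors.\<close>

lemma sum_geom_entropy_ge:
  assumes "\<And>m. 0 < m \<Longrightarrow> m \<le> n \<Longrightarrow>
    w + ln (real n * (real n + 1) / (real m * (real m + 1))) - e m \<le> geom_entropy (p m)"
  shows "w * (real n * (real n + 1) / 2) + real n * (real n - 1) / 2 - (\<Sum>m=1..n. real m * e m)
    \<le> (\<Sum>m=1..n. real m * geom_entropy (p m))"
proof -
  have "w * (real n * (real n + 1) / 2) + real n * (real n - 1) / 2 - (\<Sum>m=1..n. real m * e m)
      \<le> w * (\<Sum>m=1..n. real m)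
        + (\<Sum>m=1..n. real m * ln (real n * (real n + 1) / (real m * (real m + 1))))
        - (\<Sum>m=1..n. real m * e m)"
    using sum_ln_quotient_ge[of n] unfolding sum_real_upto by linarith
  also have "\<dots> = (\<Sum>m=1..n. real m * (w + ln (real n * (real n + 1) / (real m * (real m + 1))) - e m))"
    by (simp add: sum_distrib_left sum.distrib sum_subtractf algebra_simps)
  also have "\<dots> \<le> (\<Sum>m=1..n. real m * geom_entropy (p m))"
    using assms by (intro sum_mono mult_left_mono) auto
  finally show ?thesis .
qed

lemma sum_extend_total: "(\<Sum>i\<le>n. extend n g i) = 0"
  by (simp add: lessThan_Suc_atMost[symmetric] extend_def)

lemma sum_extend_partial: "r < n \<Longrightarrow> (\<Sum>i\<le>r. extend n g i) = (\<Sum>i\<le>r. g i)"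
  by (intro sum.cong) (auto simp: extend_def)

lemma quotient_ge_1:
  assumes "0 < m" "m \<le> n"
  shows "1 \<le> real n * (real n + 1) / (real m * (real m + 1))"
proof -
  have "real m * (real m + 1) \<le> real n * (real n + 1)"
    using assms by (intro mult_mono) auto
  then show ?thesis using assms by simp
qed

lemma linear_le_n_ln_n:
  assumes "n \<ge> 3"
  shows "- (\<bar>x\<bar> * real n * ln (real n)) \<le> x * real n / 2"
proof -
  have "1 \<le> ln (real n)"
    using assms exp_le by (subst ln_ge_iff) auto
  then have "\<bar>x\<bar> * real n * 1 \<le> \<bar>x\<bar> * real n * ln (real n)"
    by (intro mult_left_mono) auto
  moreover have "- (\<bar>x\<bar> * real n) \<le> x * real n / 2"
    using mult_right_mono[of "- \<bar>x\<bar>" "x / 2" "real n"] by auto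
  ultimately show ?thesis by simp
qed

section \<open>Constant and affine outflows\<close>

text \<open>Here \<open>b = a\<close> and \<open>c = 0\<close>, and
  \<open>geom_entropy_ge_ln\<close> gives \<open>w = 1 + ln a\<close>. The linear remainder
  \<open>ln a * n / 2\<close> goes into the error.\<close>

lemma K_constant_ge:
  fixes a :: real
  assumes a: "a > 0"
  shows "\<exists>C. \<forall>\<^sub>F n in sequentially. a * real n \<in> \<int> \<longrightarrow>
    exp (real n ^ 2 / 2 * (2 + ln a) - C * real n * ln (real n))
      \<le> real (K n (extend n (\<lambda>i. \<lfloor>a * real n\<rfloor>)))"
proof -
  have "\<forall>\<^sub>F n in sequentially. a * real n \<in> \<int> \<longrightarrow>
    exp (real n ^ 2 / 2 * (2 + ln a) - (15 + \<bar>ln a\<bar>) * real n * ln (real n))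
      \<le> real (K n (extend n (\<lambda>i. \<lfloor>a * real n\<rfloor>)))"
    using eventually_K_ge_spread[of "\<lambda>n. extend n (\<lambda>i. \<lfloor>a * real n\<rfloor>)" a 0]
      eventually_ge_at_top[of 3]
  proof eventually_elim
    case (elim n)
    show ?case
    proof
      assume "a * real n \<in> \<int>"
      then have A: "real_of_int \<lfloor>a * real n\<rfloor> = a * real n" by simp
      have sp: "spread a 0 n m = a * (real n * (real n + 1) / (real m * (real m + 1)))" for m
        by (simp add: spread_def)
      have "(1 + ln a) * (real n * (real n + 1) / 2) + real n * (real n - 1) / 2
          - (\<Sum>m=1..n. real m * 0) \<le> (\<Sum>m=1..n. real m * geom_entropy (spread a 0 n m))"
      proof (rule sum_geom_entropy_ge)
        fix m assume m: "0 < m" "m \<le> n"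
        then have pos: "real n * (real n + 1) / (real m * (real m + 1)) > 0" by auto
        have "1 + ln (spread a 0 n m) \<le> geom_entropy (spread a 0 n m)"
          unfolding sp by (intro geom_entropy_ge_ln mult_pos_pos a pos)
        moreover have "ln (spread a 0 n m) = ln a + ln (real n * (real n + 1) / (real m * (real m + 1)))"
          unfolding sp by (intro ln_mult_pos a pos)
        ultimately show "(1 + ln a) + ln (real n * (real n + 1) / (real m * (real m + 1))) - 0
          \<le> geom_entropy (spread a 0 n m)" by simp
      qed
      moreover have "- (\<bar>ln a\<bar> * real n * ln (real n)) \<le> ln a * real n / 2"
        using linear_le_n_ln_n elim by blast
      ultimately have "real n ^ 2 / 2 * (2 + ln a) - (15 + \<bar>ln a\<bar>) * real n * ln (real n)
          \<le> (\<Sum>m=1..n. real m * geom_entropy (spread a 0 n m)) - 15 * real n * ln (real n)"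
        by (simp add: algebra_simps power2_eq_square add_divide_distrib diff_divide_distrib)
      moreover have "exp ((\<Sum>m=1..n. real m * geom_entropy (spread a 0 n m)) - 15 * real n * ln (real n))
          \<le> real (K n (extend n (\<lambda>i. \<lfloor>a * real n\<rfloor>)))"
      proof (rule elim(1)[rule_format])
        show "real_of_int (\<Sum>k\<le>r. extend n (\<lambda>i. \<lfloor>a * real n\<rfloor>) k)
          = (real r + 1) * (a * real n - 0 * real (n - r))" if "r < n" for r
          using that by (simp add: sum_extend_partial A add.commute)
        show "0 \<le> spread a 0 n m" for m
          using a by (simp add: sp)
      qed (rule sum_extend_total)
      ultimately show "exp (real n ^ 2 / 2 * (2 + ln a) - (15 + \<bar>ln a\<bar>) * real n * ln (real n))
          \<le> real (K n (extend n (\<lambda>i. \<lfloor>a * real n\<rfloor>)))"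
        by (meson exp_le_cancel_iff order_trans)
    qed
  qed
  then show ?thesis by blast
qed

lemma sum_affine: "(\<Sum>k\<le>r. real_of_int (A + int k)) = (real r + 1) * (real_of_int A + real r / 2)"
  by (induction r) (auto simp: field_simps)

lemma affine_partial_sum:
  assumes A: "real_of_int A = a * real n" and "r < n"
  shows "real_of_int (\<Sum>k\<le>r. extend n (\<lambda>i. A + int i) k)
    = (real r + 1) * ((a + 1 / 2) * real n - 1 / 2 * real (n - r))"
  unfolding sum_extend_partial[OF assms(2)] of_int_sum sum_affine A
  using assms(2) by (simp add: field_simps of_nat_diff)

text \<open>With \<open>b = a + 1 / 2\<close> and \<open>c = 1 / 2\<close>, doubling the edge flow
  and adding 1 gives \<open>2 * a + 1\<close> times the quotient, the form
  \<open>geom_entropy_ge_ln_two\<close> expects; so \<open>w = ln (2 * a + 1)\<close>.\<close>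

lemma K_affine_ge:
  fixes a :: real
  assumes a: "a \<ge> 0"
  shows "\<exists>C. \<forall>\<^sub>F n in sequentially. a * real n \<in> \<int> \<longrightarrow>
    exp (real n ^ 2 / 2 * (1 + ln (2 * a + 1)) - C * real n * ln (real n))
      \<le> real (K n (extend n (\<lambda>i. \<lfloor>a * real n\<rfloor> + int i)))"
proof -
  define w where "w = ln (2 * a + 1)"
  have "\<forall>\<^sub>F n in sequentially. a * real n \<in> \<int> \<longrightarrow>
    exp (real n ^ 2 / 2 * (1 + w) - (15 + \<bar>w - 1\<bar>) * real n * ln (real n))
      \<le> real (K n (extend n (\<lambda>i. \<lfloor>a * real n\<rfloor> + int i)))"
    using eventually_K_ge_spread[of "\<lambda>n. extend n (\<lambda>i. \<lfloor>a * real n\<rfloor> + int i)" "a + 1 / 2" "1 / 2"]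
      eventually_ge_at_top[of 3]
  proof eventually_elim
    case (elim n)
    let ?p = "spread (a + 1 / 2) (1 / 2) n"
    show ?case
    proof
      assume "a * real n \<in> \<int>"
      then have A: "real_of_int \<lfloor>a * real n\<rfloor> = a * real n" by simp
      have sp: "2 * ?p m + 1 = (2 * a + 1) * (real n * (real n + 1) / (real m * (real m + 1)))" for m
        by (simp add: spread_def ring_distribs)
      have nonneg: "0 \<le> ?p m" if "0 < m" "m \<le> n" for m
      proof -
        have "1 * 1 \<le> (2 * a + 1) * (real n * (real n + 1) / (real m * (real m + 1)))"
          using a quotient_ge_1[OF that] by (intro mult_mono) auto
        then show ?thesis using sp[of m] by linarith
      qed
      have "w * (real n * (real n + 1) / 2) + real n * (real n - 1) / 2
          - (\<Sum>m=1..n. real m * 0) \<le> (\<Sum>m=1..n. real m * geom_entropy (?p m))"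
      proof (rule sum_geom_entropy_ge)
        fix m assume m: "0 < m" "m \<le> n"
        then have pos: "real n * (real n + 1) / (real m * (real m + 1)) > 0" by auto
        have "ln (2 * ?p m + 1) \<le> geom_entropy (?p m)"
          by (intro geom_entropy_ge_ln_two nonneg m)
        moreover have "ln (2 * ?p m + 1) = w + ln (real n * (real n + 1) / (real m * (real m + 1)))"
          unfolding sp w_def using a by (intro ln_mult_pos pos) auto
        ultimately show "w + ln (real n * (real n + 1) / (real m * (real m + 1))) - 0
          \<le> geom_entropy (?p m)" by simp
      qed
      moreover have "- (\<bar>w - 1\<bar> * real n * ln (real n)) \<le> (w - 1) * real n / 2"
        using linear_le_n_ln_n elim by blast
      ultimately have "real n ^ 2 / 2 * (1 + w) - (15 + \<bar>w - 1\<bar>) * real n * ln (real n)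
          \<le> (\<Sum>m=1..n. real m * geom_entropy (?p m)) - 15 * real n * ln (real n)"
        by (simp add: algebra_simps power2_eq_square add_divide_distrib diff_divide_distrib)
      moreover have "exp ((\<Sum>m=1..n. real m * geom_entropy (?p m)) - 15 * real n * ln (real n))
          \<le> real (K n (extend n (\<lambda>i. \<lfloor>a * real n\<rfloor> + int i)))"
        by (rule elim(1)[rule_format, OF sum_extend_total affine_partial_sum[OF A] nonneg])
      ultimately show "exp (real n ^ 2 / 2 * (1 + w) - (15 + \<bar>w - 1\<bar>) * real n * ln (real n))
          \<le> real (K n (extend n (\<lambda>i. \<lfloor>a * real n\<rfloor> + int i)))"
        by (meson exp_le_cancel_iff order_trans)
    qed
  qed
  then show ?thesis unfolding w_def by blast
qed

section \<open>The numerical constant for outflows \<open>n + i\<close>\<close>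

text \<open>Controls the sum of \<open>m / q m ^ 2\<close> for the quotients \<open>q m\<close>
  below. The right side grows by the new term plus a nonnegative surplus.\<close>

lemma sum_fifth_powers_le:
  "(\<Sum>m=1..n. real m * (real m * (real m + 1)) ^ 2) \<le> (real n * (real n + 1)) ^ 2 * (real n + 2) ^ 2 / 6"
proof (induction n)
  case (Suc n)
  define x where "x = real n + 1"
  have x: "real n + 1 = x" "real n + 2 = x + 1" "real (Suc n) = x" "real (Suc n) + 1 = x + 1"
    "real (Suc n) + 2 = x + 2" "real n = x - 1"
    by (simp_all add: x_def)
  have "(\<Sum>m=1..n. real m * (real m * (real m + 1)) ^ 2) \<le> ((x - 1) * x) ^ 2 * (x + 1) ^ 2 / 6"
    using Suc unfolding x(1,2) unfolding x(6) .
  moreover have "(x * (x + 1)) ^ 2 * (x + 2) ^ 2 / 6 - ((x - 1) * x) ^ 2 * (x + 1) ^ 2 / 6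
      - x * (x * (x + 1)) ^ 2 = x ^ 2 * (x + 1) ^ 2 / 2"
    by (simp add: field_simps power2_eq_square)
  moreover have "x ^ 2 * (x + 1) ^ 2 / 2 \<ge> 0" by simp
  ultimately have "(\<Sum>m=1..n. real m * (real m * (real m + 1)) ^ 2) + x * (x * (x + 1)) ^ 2
      \<le> (x * (x + 1)) ^ 2 * (x + 2) ^ 2 / 6"
    by linarith
  moreover have "(\<Sum>m=1..Suc n. real m * (real m * (real m + 1)) ^ 2)
      = (\<Sum>m=1..n. real m * (real m * (real m + 1)) ^ 2) + x * (x * (x + 1)) ^ 2"
    unfolding x(3)[symmetric] by simp
  ultimately show ?case
    unfolding x by simp
qed simp

text \<open>\<open>3 / 2\<close> is \<open>(1 + x) / (1 - x)\<close> at
  \<open>x = 1 / 5\<close>.\<close>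

lemma ln_three_halves_ge: "ln (3 / 2 :: real) \<ge> 405 / 1000"
  using ln_quotient_ge[of "1 / 5"] by (simp add: power3_eq_cube)

text \<open>The leading coefficient is at least \<open>1 + 0.2025 - 1 / 270 > 1.198\<close>; the
  linear and constant terms together are nonnegative for \<open>x >= 1\<close>.\<close>

lemma quadratic_bound:
  fixes x l :: real
  assumes "x \<ge> 1" "l \<ge> 405 / 1000"
  shows "1.198 * x ^ 2 \<le> (1 + l) * (x * (x + 1) / 2) + x * (x - 1) / 2 - (x + 2) ^ 2 / 270"
proof -
  define A where "A = x * (x + 1) / 2"
  define q where "q = x * x"
  have A: "A = q / 2 + x / 2" and "(1 + l) * A = A + l * A"
    "x * (x - 1) / 2 = q / 2 - x / 2" "(x + 2) ^ 2 = q + 4 * x + 4"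
    by (simp_all add: A_def q_def algebra_simps power2_eq_square add_divide_distrib diff_divide_distrib)
  moreover have "405 / 1000 * A \<le> l * A"
    using assms by (intro mult_right_mono) (auto simp: A_def)
  moreover have "x * 1 \<le> q"
    unfolding q_def using assms by (intro mult_left_mono) auto
  ultimately have "1198 / 1000 * q \<le> (1 + l) * A + x * (x - 1) / 2 - (x + 2) ^ 2 / 270"
    using assms(1) by linarith
  moreover have "(1.198::real) = 1198 / 1000" by simp
  ultimately show ?thesis by (simp only: A_def q_def power2_eq_square)
qed

text \<open>\<open>K_affine_ge\<close> at \<open>a = 1\<close> has only the coefficient
  \<open>(1 + ln 3) / 2\<close>, about 1.05. The midpoint expansion with
  \<open>M = 3 / 2 * q m\<close> gives \<open>1 + ln (3 / 2) / 2\<close> instead, minus errors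
  \<open>1 / (45 * q m ^ 2)\<close> of total weight about \<open>n ^ 2 / 270\<close>.\<close>

lemma K_n_plus_i_ge:
  "\<exists>C. \<forall>\<^sub>F n in sequentially. exp (1.198 * real n ^ 2 - C * real n * ln (real n))
    \<le> real (K n (extend n (\<lambda>i. int n + int i)))"
proof -
  have "\<forall>\<^sub>F n in sequentially. exp (1.198 * real n ^ 2 - 15 * real n * ln (real n))
    \<le> real (K n (extend n (\<lambda>i. int n + int i)))"
    using eventually_K_ge_spread[of "\<lambda>n. extend n (\<lambda>i. int n + int i)" "3 / 2" "1 / 2"]
      eventually_gt_at_top[of 0]
  proof eventually_elim
    case (elim n)
    let ?p = "spread (3 / 2) (1 / 2) n"
    define q where "q m = real n * (real n + 1) / (real m * (real m + 1))" for m
    have sp: "?p m = 3 / 2 * q m - 1 / 2" for m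
      by (simp add: spread_def q_def)
    have q: "1 \<le> q m" if "0 < m" "m \<le> n" for m
      unfolding q_def by (rule quotient_ge_1[OF that])
    define e where "e m = 1 / (45 * q m ^ 2)" for m
    have "(1 + ln (3 / 2)) * (real n * (real n + 1) / 2) + real n * (real n - 1) / 2
        - (\<Sum>m=1..n. real m * e m) \<le> (\<Sum>m=1..n. real m * geom_entropy (?p m))"
    proof (rule sum_geom_entropy_ge)
      fix m assume m: "0 < m" "m \<le> n"
      have "1 + ln (3 / 2 * q m) - 1 / (20 * (3 / 2 * q m) ^ 2) \<le> geom_entropy (?p m)"
        unfolding sp by (rule geom_entropy_shift_ge) (use q[OF m] in simp)
      moreover have "1 / (20 * (3 / 2 * q m) ^ 2) = e m"
        by (simp add: e_def power2_eq_square)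
      moreover have "ln (3 / 2 * q m) = ln (3 / 2) + ln (q m)"
        using q[OF m] by (intro ln_mult_pos) auto
      ultimately show "1 + ln (3 / 2) + ln (real n * (real n + 1) / (real m * (real m + 1))) - e m
          \<le> geom_entropy (?p m)"
        by (simp add: q_def)
    qed
    moreover have "(\<Sum>m=1..n. real m * e m) \<le> (real n + 2) ^ 2 / 270"
    proof -
      define X where "X = (real n * (real n + 1)) ^ 2"
      have X: "X > 0" using elim by (simp add: X_def)
      have "(\<Sum>m=1..n. real m * e m) = (\<Sum>m=1..n. real m * (real m * (real m + 1)) ^ 2) / (45 * X)"
        unfolding sum_divide_distrib by (intro sum.cong refl) (simp add: e_def q_def X_def power_divide)
      also have "\<dots> \<le> X * (real n + 2) ^ 2 / 6 / (45 * X)"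
        using sum_fifth_powers_le[of n] X by (intro divide_right_mono) (auto simp: X_def)
      also have "\<dots> = (real n + 2) ^ 2 / 270" using X by simp
      finally show ?thesis .
    qed
    moreover have "1.198 * real n ^ 2
        \<le> (1 + ln (3 / 2)) * (real n * (real n + 1) / 2) + real n * (real n - 1) / 2 - (real n + 2) ^ 2 / 270"
      using elim by (intro quadratic_bound ln_three_halves_ge) auto
    ultimately have "1.198 * real n ^ 2 - 15 * real n * ln (real n)
        \<le> (\<Sum>m=1..n. real m * geom_entropy (?p m)) - 15 * real n * ln (real n)"
      by linarith
    moreover have "exp ((\<Sum>m=1..n. real m * geom_entropy (?p m)) - 15 * real n * ln (real n))
        \<le> real (K n (extend n (\<lambda>i. int n + int i)))"
    proof (rule elim(1)[rule_format, OF sum_extend_total])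
      show "0 \<le> ?p m" if "0 < m" "m \<le> n" for m
        using q[OF that] by (simp add: sp)
      show "real_of_int (\<Sum>k\<le>r. extend n (\<lambda>i. int n + int i) k)
        = (real r + 1) * (3 / 2 * real n - 1 / 2 * real (n - r))" if "r < n" for r
        using affine_partial_sum[of "int n" 1 n r] that by simp
    qed
    ultimately show ?case
      by (meson exp_le_cancel_iff order_trans)
  qed
  then show ?thesis by blast
qed

section \<open>Outflows \<open>t * (n - 2 * i)\<close>\<close>

lemma geom_entropy_of_nat:
  assumes "t \<ge> 1"
  shows "geom_entropy (real t) = ln ((1 + real t) ^ (1 + t) / real t ^ t)"
proof -
  have "ln ((1 + real t) ^ (1 + t) / real t ^ t) = ln ((1 + real t) ^ (1 + t)) - ln (real t ^ t)"
    using assms by (intro ln_divide_pos) auto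
  also have "\<dots> = real (1 + t) * ln (1 + real t) - real t * ln (real t)"
    using assms by (simp only: ln_realpow)
  finally show ?thesis by (simp add: geom_entropy_def add.commute)
qed

lemma sum_two_rho_partial: "(\<Sum>k\<le>r. t * (int n - 2 * int k)) = t * ((int r + 1) * (int n - int r))"
  by (induction r) (auto simp: algebra_simps)

text \<open>The capacity of cut \<open>r\<close> is \<open>t * (r + 1) * (n - r)\<close>, so the
  uniform flow is \<open>t\<close> on every edge and all entropies agree. \<open>t\<close> affects
  the threshold for \<open>n\<close> but not the constant 15.\<close>

lemma K_two_rho_ge:
  fixes t :: nat
  assumes t: "t \<ge> 1"
  shows "\<forall>\<^sub>F n in sequentially.
    exp (real n ^ 2 / 2 * ln ((1 + real t) ^ (1 + t) / real t ^ t) - 15 * real n * ln (real n * real t))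
      \<le> real (K n (\<lambda>i. int t * (int n - 2 * int i)))"
  using eventually_K_ge_spread[of "\<lambda>n i. int t * (int n - 2 * int i)" 0 "- real t"]
    eventually_gt_at_top[of 0]
proof eventually_elim
  case (elim n)
  let ?h = "geom_entropy (real t)"
  have sp: "spread 0 (- real t) n m = real t" for m
    by (simp add: spread_def)
  have "real n ^ 2 / 2 * ?h \<le> real n * (real n + 1) / 2 * ?h"
    by (intro mult_right_mono geom_entropy_nonneg) (auto simp: power2_eq_square algebra_simps)
  also have "\<dots> = (\<Sum>m=1..n. real m * ?h)"
    unfolding sum_real_upto[symmetric] sum_distrib_right ..
  finally have "real n ^ 2 / 2 * ?h \<le> (\<Sum>m=1..n. real m * geom_entropy (spread 0 (- real t) n m))"
    unfolding sp .
  moreover have "15 * real n * ln (real n) \<le> 15 * real n * ln (real n * real t)"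
    using elim t by (intro mult_left_mono) auto
  ultimately have "real n ^ 2 / 2 * ?h - 15 * real n * ln (real n * real t)
      \<le> (\<Sum>m=1..n. real m * geom_entropy (spread 0 (- real t) n m)) - 15 * real n * ln (real n)"
    by linarith
  moreover have "exp ((\<Sum>m=1..n. real m * geom_entropy (spread 0 (- real t) n m)) - 15 * real n * ln (real n))
      \<le> real (K n (\<lambda>i. int t * (int n - 2 * int i)))"
  proof (rule elim(1)[rule_format])
    show "real_of_int (\<Sum>k\<le>r. int t * (int n - 2 * int k))
      = (real r + 1) * (0 * real n - - real t * real (n - r))" if "r < n" for r
      unfolding sum_two_rho_partial using that by (simp add: of_nat_diff algebra_simps)
  qed (auto simp: sum_two_rho_partial sp)
  ultimately show ?case
    unfolding geom_entropy_of_nat[OF t] by (meson exp_le_cancel_iff order_trans)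
qed

section \<open>One source and one sink\<close>

text \<open>Choosing any set of edges of length between \<open>2\<close> and \<open>D\<close> keeps all cuts below \<open>D\<^sup>2\<close>.\<close>
lemma K_unit_ge:
  assumes D: "D * D \<le> t" "D \<ge> 1" and n: "D \<le> n"
  shows "2 ^ ((n - D + 1) * (D - 1)) \<le> K n (\<lambda>i. if i = 0 then int t else if i = n then - int t else 0)"
proof -
  \<comment> \<open>Lengths start at 2 to keep the path edges for slack. Stopping at
    \<open>n - D\<close> gives each tail all \<open>D - 1\<close> lengths.\<close>
  define E where "E = Sigma {..n - D} (\<lambda>i. {i + 2..i + D})"
  define \<Phi> :: "(nat \<times> nat) set \<Rightarrow> nat \<Rightarrow> nat \<Rightarrow> nat"
    where "\<Phi> A i j = (if (i, j) \<in> A then 1 else 0)" for A i j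
  have E: "i + 2 \<le> j \<and> j \<le> i + D \<and> j \<le> n" if "(i, j) \<in> E" for i j
    using that n by (auto simp: E_def)
  have "finite E" by (auto simp: E_def)
  have "card E = (n - D + 1) * (D - 1)"
    using D by (simp add: E_def)
  then have "2 ^ ((n - D + 1) * (D - 1)) = card (Pow E)"
    using \<open>finite E\<close> by (simp add: card_Pow)
  also have "\<dots> \<le> K n (\<lambda>i. if i = 0 then int t else if i = n then - int t else 0)"
  proof (rule card_le_K[where \<Phi> = \<Phi>])
    show "(\<Sum>i\<le>n. if i = 0 then int t else if i = n then - int t else 0) = 0"
    proof -
      have "(\<Sum>i\<le>n. if i = 0 then int t else if i = n then - int t else 0)
        = (\<Sum>i\<le>n. (if i = 0 then int t else 0) + (if i = n then - int t else 0))"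
        using n D by (intro sum.cong) auto
      then show ?thesis by (simp add: sum.distrib)
    qed
  next
    fix A i j assume "A \<in> Pow E" "\<not> (i < j \<and> j \<le> n)"
    then have "(i, j) \<notin> A" using E[of i j] by auto
    then show "\<Phi> A i j = 0" by (simp add: \<Phi>_def)
  next
    fix A r assume A: "A \<in> Pow E" and r: "r < n"
    have "(\<Sum>j\<in>{r<..n}. \<Phi> A i j) \<le> (if i \<in> {r + 1 - D..r} then D else 0)" if "i \<le> r" for i
    proof -
      have "(\<Sum>j\<in>{r<..n}. \<Phi> A i j) \<le> (\<Sum>j\<in>{r<..n}. if j \<in> {r<..i + D} then 1 else 0)"
        using A E by (intro sum_mono) (fastforce simp: \<Phi>_def)
      also have "\<dots> = card ({r<..n} \<inter> {r<..i + D})"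
        unfolding card_eq_sum by (rule sum.inter_restrict[symmetric]) simp
      also have "\<dots> \<le> card {r<..i + D}"
        by (intro card_mono) auto
      finally show ?thesis using that by auto
    qed
    \<comment> \<open>Only the last \<open>D\<close> tails up to \<open>r\<close> reach across the
      cut, each with at most \<open>D\<close> edges; near 0 the truncated subtraction just leaves
      fewer tails.\<close>
    then have "cut_flow n (\<Phi> A) r \<le> (\<Sum>i\<le>r. if i \<in> {r + 1 - D..r} then D else 0)"
      unfolding cut_flow_def by (intro sum_mono) blast
    also have "\<dots> = (\<Sum>i\<in>{..r} \<inter> {r + 1 - D..r}. D)"
      by (rule sum.inter_restrict[symmetric]) simp
    also have "\<dots> \<le> (\<Sum>i\<in>{r + 1 - D..r}. D)"
      by (rule sum_mono2) auto
    also have "\<dots> \<le> D * D" by auto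
    finally have "cut_flow n (\<Phi> A) r \<le> t" using D by simp
    moreover have "(\<Sum>i\<le>r. if i = 0 then int t else if i = n then - int t else 0) = (\<Sum>i\<le>r. if i = 0 then int t else 0)"
      using r by (intro sum.cong) auto
    ultimately show "int (cut_flow n (\<Phi> A) r) \<le> (\<Sum>i\<le>r. if i = 0 then int t else if i = n then - int t else 0)"
      by simp
  next
    fix A B assume AB: "A \<in> Pow E" "B \<in> Pow E" and eq: "\<And>i j. j \<noteq> Suc i \<Longrightarrow> \<Phi> A i j = \<Phi> B i j"
    have "(i, j) \<in> A \<longleftrightarrow> (i, j) \<in> B" for i j
    proof (cases "j = Suc i")
      case True
      then show ?thesis using AB E[of i j] by auto
    next
      case False
      then show ?thesis using eq[of j i] by (simp add: \<Phi>_def split: if_splits)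
    qed
    then show "A = B" by auto
  qed
  finally show ?thesis .
qed

text \<open>The constant 60 makes the left side at most \<open>- 3 * L\<close> up to
  \<open>L = 114\<close>. Beyond that, the exponential exceeds \<open>(L / 12) ^ 4\<close>, which
  dominates \<open>L ^ 2 / 2\<close> once \<open>L ^ 2 >= 10368\<close>.\<close>

lemma log_square_le_sqrt:
  fixes L :: real
  assumes "L \<ge> 1"
  shows "L ^ 2 / 2 - 60 * L \<le> 2 powr (L / 2) - 3"
proof (cases "L \<le> 114")
  case True
  have "L ^ 2 / 2 \<le> 57 * L" using True assms by (simp add: power2_eq_square)
  moreover have "0 < 2 powr (L / 2)" by simp
  ultimately show ?thesis using assms by linarith
next
  case False
  have "2 / 3 \<le> ln (2::real)" using ln_divide_ge[of 1 2] by simp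
  then have "L * (2 / 3) \<le> L * ln 2" using assms by (intro mult_left_mono) auto
  moreover have "1 + L / 2 * ln 2 / 4 \<le> exp (L / 2 * ln 2 / 4)"
    by (rule exp_ge_add_one_self)
  ultimately have "L / 12 \<le> exp (L / 2 * ln 2 / 4)"
    by linarith
  then have "(L / 12) ^ 4 \<le> exp (L / 2 * ln 2 / 4) ^ 4"
    using assms by (intro power_mono) auto
  also have "\<dots> = 2 powr (L / 2)"
    by (simp add: powr_def exp_of_nat_mult[symmetric])
  finally have "(L / 12) ^ 4 \<le> 2 powr (L / 2)" .
  moreover have "L ^ 2 / 2 \<le> (L / 12) ^ 4"
  proof -
    have "114 ^ 2 \<le> L ^ 2" using False by (intro power_mono) auto
    then have "L ^ 2 * 10368 \<le> L ^ 2 * L ^ 2" by (intro mult_left_mono) auto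
    then show ?thesis by (simp add: power2_eq_square power4_eq_xxxx)
  qed
  ultimately show ?thesis using assms by linarith
qed

text \<open>With \<open>D\<close> the integer part of \<open>sqrt t\<close>,
  \<open>K_unit_ge\<close> gives an exponent of order \<open>n * sqrt t\<close>, far above the
  squared logarithm for large \<open>t\<close>; for small \<open>t\<close> the error term makes the
  claim trivial.\<close>

lemma K_unit_source_sink_ge:
  fixes t :: nat
  assumes t: "t \<ge> 1"
  shows "\<forall>\<^sub>F n in sequentially.
    2 powr (real n / 2 * (log 2 (real t)) ^ 2 - 60 * real n * log 2 (real t))
      \<le> real (K n (\<lambda>i. if i = 0 then int t else if i = n then - int t else 0))"
  using eventually_ge_at_top[of "t + 1"]
proof eventually_elim
  case (elim n)
  define D where "D = nat \<lfloor>sqrt (real t)\<rfloor>"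
  define L where "L = log 2 (real t)"
  let ?K = "K n (\<lambda>i. if i = 0 then int t else if i = n then - int t else 0)"
  have D: "real D \<le> sqrt (real t)" "sqrt (real t) \<le> real D + 1"
    by (auto simp: D_def)
  have D1: "D \<ge> 1" using t by (simp add: D_def le_nat_iff)
  have "real D ^ 2 \<le> sqrt (real t) ^ 2" using D by (intro power_mono) auto
  then have "real (D * D) \<le> real t" by (simp add: power2_eq_square)
  then have DD: "D * D \<le> t" by (simp only: of_nat_le_iff)
  then have Dn: "D \<le> n" using elim D1 by (metis le_square order_trans add_leD1)
  have "2 powr (real n / 2 * L ^ 2 - 60 * real n * L) \<le> 2 powr real ((n - D + 1) * (D - 1))"
  proof (cases "t = 1")
    case True
    then show ?thesis by (simp add: L_def ge_one_powr_ge_zero del: of_nat_mult)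
  next
    case False
    then have "log 2 2 \<le> L" using t unfolding L_def by (intro log_mono) auto
    then have L: "L \<ge> 1" by simp
    have "real t = 2 powr L" using t by (simp add: L_def)
    then have "sqrt (real t) = 2 powr (L / 2)" by (simp add: powr_half_sqrt[symmetric] powr_powr)
    then have "L ^ 2 / 2 - 60 * L \<le> real D - 2"
      using log_square_le_sqrt[OF L] D by linarith
    then have "real n * (L ^ 2 / 2 - 60 * L) \<le> real n * (real D - 2)"
      by (intro mult_left_mono) auto
    \<comment> \<open>The difference is \<open>n - D * D + 2 * D - 1\<close>, nonnegative because
      \<open>D * D <= t < n\<close>.\<close>
    also have "\<dots> \<le> (real n - real D + 1) * (real D - 1)"
    proof -
      have "(real n - real D + 1) * (real D - 1) - real n * (real D - 2)
          = real n - (real D * real D) + 2 * real D - 1" by (simp add: algebra_simps)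
      moreover have "real D * real D \<le> real n"
        using DD elim by (metis add_leD1 of_nat_le_iff of_nat_mult order_trans)
      ultimately show ?thesis using D1 by simp
    qed
    also have "\<dots> = real ((n - D + 1) * (D - 1))"
    proof -
      have "real (n - D) = real n - real D" "real (D - 1) = real D - 1"
        using Dn D1 by (auto simp: of_nat_diff)
      then show ?thesis by (simp only: of_nat_mult of_nat_add of_nat_1)
    qed
    finally show ?thesis by (intro powr_mono) (auto simp: algebra_simps)
  qed
  also have "\<dots> = real (2 ^ ((n - D + 1) * (D - 1)))"
    by (subst powr_realpow) simp_all
  also have "\<dots> \<le> real ?K"
    using K_unit_ge[OF DD D1 Dn] by (simp only: of_nat_le_iff)
  finally show ?case by (simp add: L_def)
qed

theorem theorem5p3:
  shows
  "(\<exists>C. \<forall>\<^sub>F n in sequentially.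
      exp (real n ^ 2 - C * real n * ln (real n))
        \<le> real (K n (extend n (\<lambda>i. int n))))
 \<and> (\<forall>a::real. a \<ge> 1/12 \<longrightarrow> (\<exists>C. \<forall>\<^sub>F n in sequentially.
      a * real n \<in> \<int> \<longrightarrow>
      exp (real n ^ 2 / 2 * (2 + ln a) - C * real n * ln (real n))
        \<le> real (K n (extend n (\<lambda>i. \<lfloor>a * real n\<rfloor>)))))
 \<and> (\<forall>a::real. a \<ge> 0 \<longrightarrow> (\<exists>C. \<forall>\<^sub>F n in sequentially.
      a * real n \<in> \<int> \<longrightarrow>
      exp (real n ^ 2 / 2 * (1 + ln (2 * a + 1)) - C * real n * ln (real n))
        \<le> real (K n (extend n (\<lambda>i. \<lfloor>a * real n\<rfloor> + int i)))))
 \<and> (\<exists>C. \<forall>\<^sub>F n in sequentially.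
      exp (1.198 * real n ^ 2 - C * real n * ln (real n))
        \<le> real (K n (extend n (\<lambda>i. int n + int i))))
 \<and> (\<exists>C. \<forall>t::nat. t \<ge> 1 \<longrightarrow> (\<forall>\<^sub>F n in sequentially.
      2 powr (real n / 2 * (log 2 (real t)) ^ 2 - C * real n * log 2 (real t))
        \<le> real (K n (\<lambda>i. if i = 0 then int t else if i = n then - int t else 0))))
 \<and> (\<exists>C. \<forall>t::nat. t \<ge> 1 \<longrightarrow> (\<forall>\<^sub>F n in sequentially.
      exp (real n ^ 2 / 2 * ln ((1 + real t) ^ (1 + t) / real t ^ t)
           - C * real n * ln (real n * real t))
        \<le> real (K n (\<lambda>i. int t * (int n - 2 * int i)))))"
proof (intro conjI allI impI)
  show "\<exists>C. \<forall>\<^sub>F n in sequentially. exp (real n ^ 2 - C * real n * ln (real n))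
      \<le> real (K n (extend n (\<lambda>i. int n)))"
    using K_constant_ge[of 1] by simp
next
  show "\<exists>C. \<forall>t::nat. t \<ge> 1 \<longrightarrow> (\<forall>\<^sub>F n in sequentially.
      2 powr (real n / 2 * (log 2 (real t)) ^ 2 - C * real n * log 2 (real t))
        \<le> real (K n (\<lambda>i. if i = 0 then int t else if i = n then - int t else 0)))"
    using K_unit_source_sink_ge by blast
next
  show "\<exists>C. \<forall>t::nat. t \<ge> 1 \<longrightarrow> (\<forall>\<^sub>F n in sequentially.
      exp (real n ^ 2 / 2 * ln ((1 + real t) ^ (1 + t) / real t ^ t)
           - C * real n * ln (real n * real t))
        \<le> real (K n (\<lambda>i. int t * (int n - 2 * int i))))"
    using K_two_rho_ge by blast
qed (intro K_constant_ge K_affine_ge K_n_plus_i_ge; simp)+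

end
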